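(* Let $q$ be a prime power and let $k<n$ be positive integers with $k\mid n$. Then $$P(n,k,q)\ \ge\ \frac{|\mathrm{GL}(n,q)|}{\left(\frac{q^{n}-1}{q^{k}-1}\right)^{2}q^{k(n-k)}\,|\mathrm{GL}(k,q)|\,|\mathrm{GL}(n-k,q)|-\frac{(q^{n}-1)^{2}}{q^{k}-1}+(q^{n}-1)}.$$
   Context: $V(n,q)$ denotes an $n$-dimensional vector space over the finite field $\mathbb{F}_q$, and $\mathrm{GL}(n,q)$ is the group of invertible $\mathbb{F}_q$-linear maps of it. A $k$-spread of $V(n,q)$ is a set of $k$-dimensional $\mathbb{F}_q$-subspaces of $V(n,q)$ such that every nonzero vector lies in exactly one of them. A partial $k$-parallelism of $V(n,q)$ is a collection of $k$-spreads of $V(n,q)$ that are pairwise disjoint as sets of subspaces (no $k$-dimensional subspace belongs to two of the spreads). $P(n,k,q)$ denotes the maximum size (number of spreads) of a partial $k$-parallelism of $V(n,q)$. *)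

theory Defs
  imports "HOL-Number_Theory.Prime_Powers" "HOL-Library.Cardinality"
    "HOL-Library.Function_Algebras" "HOL-Library.FuncSet" "HOL-Library.Disjoint_Sets"
begin

text \<open>
  A finite field is a type \<open>'f\<close> of classes \<open>field\<close> and \<open>finite\<close>.
  The space \<open>V(n,q)\<close>, where \<open>q = CARD('f)\<close>, is the space of vectors
  \<open>(v 0, \<dots>, v (n - 1))\<close>. They are stored as functions on all naturals that vanish from
  \<open>n\<close> onwards, so that \<open>n\<close> is an ordinary natural number and subspaces and dimensions are those
  of the ambient space \<open>nat \<Rightarrow> 'f\<close> (with the pointwise operations).
\<close>

definition vscale :: "'f::field \<Rightarrow> (nat \<Rightarrow> 'f) \<Rightarrow> nat \<Rightarrow> 'f" where
  "vscale c v = (\<lambda>i. c * v i)"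

interpretation fvec: vector_space vscale
  by unfold_locales (auto simp: vscale_def fun_eq_iff algebra_simps)

definition V :: "'f::field itself \<Rightarrow> nat \<Rightarrow> (nat \<Rightarrow> 'f) set" where
  "V _ n = {v. \<forall>i\<ge>n. v i = 0}"

text \<open>
  The maps in \<open>GL\<close> are taken to be extensional (\<open>undefined\<close> outside \<open>V\<close>), so that each
  invertible linear map of \<open>V\<close> is represented by exactly one function.
\<close>

definition GL :: "'f::field itself \<Rightarrow> nat \<Rightarrow> ((nat \<Rightarrow> 'f) \<Rightarrow> nat \<Rightarrow> 'f) set" where
  "GL F n = {g \<in> extensional (V F n). bij_betw g (V F n) (V F n) \<and>
     (\<forall>x\<in>V F n. \<forall>y\<in>V F n. g (x + y) = g x + g y) \<and>
     (\<forall>c. \<forall>x\<in>V F n. g (vscale c x) = vscale c (g x))}"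

definition k_subspaces :: "'f::field itself \<Rightarrow> nat \<Rightarrow> nat \<Rightarrow> (nat \<Rightarrow> 'f) set set" where
  "k_subspaces F n k = {U. U \<subseteq> V F n \<and> fvec.subspace U \<and> fvec.dim U = k}"

definition k_spread ::
  "'f::field itself \<Rightarrow> nat \<Rightarrow> nat \<Rightarrow> (nat \<Rightarrow> 'f) set set \<Rightarrow> bool" where
  "k_spread F n k S \<longleftrightarrow>
     S \<subseteq> k_subspaces F n k \<and> (\<forall>v\<in>V F n - {0}. \<exists>!U. U \<in> S \<and> v \<in> U)"

definition partial_k_parallelism ::
  "'f::field itself \<Rightarrow> nat \<Rightarrow> nat \<Rightarrow> (nat \<Rightarrow> 'f) set set set \<Rightarrow> bool" where
  "partial_k_parallelism F n k C \<longleftrightarrow> (\<forall>S\<in>C. k_spread F n k S) \<and> disjoint C"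

text \<open>
  As \<open>'f\<close> is finite, there are only finitely many partial parallelisms, each of them finite, and
  the empty one is always among them; hence the maximum exists.
\<close>

definition P :: "'f::{field,finite} itself \<Rightarrow> nat \<Rightarrow> nat \<Rightarrow> nat" where
  "P F n k = Max (card ` {C. partial_k_parallelism F n k C})"

end

theory Submission
  imports Defs "HOL-Number_Theory.Residues" "HOL-Algebra.Algebraic_Closure_Type"
begin

text \<open>
  Let \<open>S\<close> be the Desarguesian spread, \<open>N = (q^n - 1) / (q^k - 1)\<close> its size and
  \<open>s = q^(k (n - k)) |GL(k,q)| |GL(n - k,q)|\<close> the number of elements of \<open>GL(n,q)\<close> that map one
  given \<open>k\<close>-subspace to another. For fixed \<open>g\<close>, summing over the \<open>N^2\<close> pairs \<open>U, W \<in> S\<close> the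
  number of \<open>h\<close> with \<open>h U = g W\<close> counts every \<open>h\<close> such that \<open>h S\<close> and \<open>g S\<close> share a member, and it
  counts \<open>N\<close> times each of the \<open>q^n - 1\<close> elements \<open>g z\<close> with \<open>z\<close> in the Singer cycle, as \<open>z S = S\<close>.
  So at most \<open>N^2 s - (q^n - 1) (N - 1)\<close> elements \<open>h\<close> conflict with \<open>g\<close>, and this is the
  denominator of the bound. A maximal set of pairwise non-conflicting elements therefore yields
  sufficiently many disjoint translates of \<open>S\<close>.
\<close>

subsection \<open>Finite subfields of the algebraic closure\<close>

text \<open>Over an algebraically closed field \<open>p\<close> is a product of linear factors. A
  factor occurring twice would give a common root of \<open>p\<close> and its derivative, so each
  root occurs once in the multiset \<open>A\<close>, whose size is the degree.\<close>

lemma card_roots_separable: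
  fixes p :: "'a::alg_closed_field poly"
  assumes "p \<noteq> 0" and sep: "\<And>a. poly p a = 0 \<Longrightarrow> poly (pderiv p) a \<noteq> 0"
  shows "card {x. poly p x = 0} = degree p"
proof -
  obtain A where A: "size A = degree p" "p = smult (lead_coeff p) (\<Prod>x\<in>#A. [:-x, 1:])"
    using alg_closed_imp_factorization[OF assms(1)] by blast
  have roots: "{x. poly p x = 0} = set_mset A"
    by (subst A(2)) (auto simp: poly_prod_mset \<open>p \<noteq> 0\<close> prod_mset_zero_iff)
  have "count A a \<le> 1" for a
  proof (rule ccontr)
    assume "\<not> count A a \<le> 1"
    then have "a \<in># A" "a \<in># A - {#a#}"
      by (auto simp: in_diff_count count_greater_zero_iff[symmetric] simp del: count_greater_zero_iff)
    then obtain B where B: "A = add_mset a (add_mset a B)"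
      by (metis insert_DiffM)
    define r where "r = smult (lead_coeff p) (\<Prod>x\<in>#B. [:-x, 1:])"
    have "p = [:-a, 1:] * ([:-a, 1:] * r)"
      by (subst A(2)) (simp add: B r_def del: mult_pCons_left mult_pCons_right)
    then have "poly p a = 0" "poly (pderiv p) a = 0"
      by (simp_all add: pderiv_mult del: mult_pCons_left)
    with sep show False by blast
  qed
  then have "count A a = 1" if "a \<in># A" for a
    using that by (metis One_nat_def Suc_leI count_greater_zero_iff le_antisym)
  then have "size A = card (set_mset A)"
    by (simp add: size_multiset_overloaded_eq)
  then show ?thesis
    using A(1) roots by simp
qed

text \<open>In an algebraically closed field, with \<open>m\<close> a positive power of the
  characteristic, this is the subfield GF(m). The fields GF(q^k) and GF(q^n) are modelled this way,
  inside one common field.\<close>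

definition frob_fixed :: "nat \<Rightarrow> 'a::monoid_mult set" where
  "frob_fixed m = {x. x ^ m = x}"

lemma frob_fixed_mult: "x \<in> frob_fixed m \<Longrightarrow> y \<in> frob_fixed m \<Longrightarrow> x * y \<in> frob_fixed m"
  for x :: "'a::comm_monoid_mult"
  by (simp add: frob_fixed_def power_mult_distrib)

lemma frob_fixed_inverse: "x \<in> frob_fixed m \<Longrightarrow> inverse x \<in> frob_fixed m"
  for x :: "'a::field"
  by (simp add: frob_fixed_def power_inverse)

lemma frob_fixed_1: "1 \<in> frob_fixed m"
  by (simp add: frob_fixed_def)

lemma frob_fixed_0: "m > 0 \<Longrightarrow> 0 \<in> (frob_fixed m :: 'a::semiring_1 set)"
  by (simp add: frob_fixed_def zero_power)

lemma frob_fixed_add: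
  fixes x :: "'a::comm_semiring_1"
  assumes "Factorial_Ring.prime CHAR('a)" "m = CHAR('a) ^ j" "x \<in> frob_fixed m" "y \<in> frob_fixed m"
  shows "x + y \<in> frob_fixed m"
  using assms freshmans_dream'[OF assms(1,2), of x y] by (simp add: frob_fixed_def)

text \<open>With \<open>m = q\<close> this puts the scalars into every GF(q^t), and with
  \<open>m = q^k\<close> it gives the inclusion of GF(q^k) in GF(q^n) when k divides n.\<close>

lemma frob_fixed_power:
  assumes "x \<in> frob_fixed m"
  shows "x \<in> frob_fixed (m ^ t)"
proof -
  have "x ^ m = x"
    using assms by (simp add: frob_fixed_def)
  then have "x ^ (m ^ t) = x"
    by (induction t) (simp_all add: power_mult)
  then show ?thesis
    by (simp add: frob_fixed_def)
qed

text \<open>The elements are the roots of x^m - x. As \<open>m\<close> is zero in the field, the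
  derivative is -1 and has no root, so all roots are simple.\<close>

lemma card_frob_fixed:
  assumes "of_nat m = (0::'a::alg_closed_field)" "m > 1"
  shows "card (frob_fixed m :: 'a set) = m"
proof -
  define p :: "'a poly" where "p = monom 1 m - monom 1 1"
  have pd: "pderiv p = - 1"
    using assms(1) by (simp add: p_def pderiv_diff pderiv_monom)
  have deg: "degree p = m"
    using assms(2) degree_add_eq_left[of "- monom 1 1" "monom (1::'a) m"]
    by (simp add: p_def degree_monom_eq)
  have "card {x. poly p x = 0} = degree p"
    by (rule card_roots_separable) (use deg assms(2) in \<open>auto simp: pd\<close>)
  moreover have "{x. poly p x = 0} = frob_fixed m"
    by (auto simp: p_def poly_monom frob_fixed_def)
  ultimately show ?thesis
    using deg by simp
qed

text \<open>Multiplication by a nonzero \<open>x\<close> permutes the nonzero elements; comparing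
  their product before and after gives x^(q-1) = 1.\<close>

lemma finite_field_power_card:
  fixes x :: "'f::{field,finite}"
  shows "x ^ CARD('f) = x"
proof (cases "x = 0")
  case False
  have "bij_betw ((*) x) (UNIV - {0}) (UNIV - {0})"
    by (rule bij_betwI[where g = "\<lambda>y. y / x"]) (use False in auto)
  then have "\<Prod>(UNIV - {0}) = (\<Prod>y\<in>UNIV - {0}. x * y)"
    using prod.reindex_bij_betw[of "(*) x" "UNIV - {0}" "UNIV - {0}" "\<lambda>y. y"] by simp
  also have "\<dots> = x ^ (CARD('f) - 1) * \<Prod>(UNIV - {0})"
    by (simp add: prod.distrib card_Diff_singleton)
  finally have "x ^ (CARD('f) - 1) = 1"
    by simp
  moreover have "CARD('f) = Suc (CARD('f) - 1)"
    by simp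
  ultimately show ?thesis
    by (metis power_Suc mult.right_neutral)
qed simp

text \<open>The characteristic is a prime dividing the order p^j, hence equals p. Additivity of x ->
  x^(q^m) is available only for powers of the characteristic.\<close>

lemma CARD_eq_CHAR_power:
  assumes "primepow CARD('f::{field,finite})"
  obtains j where "Factorial_Ring.prime CHAR('f)" "j > 0" "CARD('f) = CHAR('f) ^ j"
proof -
  have pr: "Factorial_Ring.prime CHAR('f)"
    by (intro prime_CHAR_semidom finite_imp_CHAR_pos finite)
  moreover from assms obtain p j where p: "Factorial_Ring.prime p" "j > 0" "CARD('f) = p ^ j"
    by (auto simp: primepow_def)
  moreover have "CHAR('f) dvd CARD('f)"
    by (rule CHAR_dvd_CARD)
  ultimately have "CHAR('f) = p"
    by (metis prime_dvd_power primes_dvd_imp_eq)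
  with pr p that show thesis by blast
qed

subsection \<open>Counting independent lists\<close>

text \<open>Taking linear combinations is a bijection from coefficient functions on \<open>B\<close>
  to the span. The functions are extensional, so that each choice of coefficients is counted
  once.\<close>

lemma (in vector_space) card_span_independent:
  assumes "finite B" "independent B"
  shows "card (span B) = card (UNIV :: 'a set) ^ card B"
proof -
  let ?f = "\<lambda>u. \<Sum>v\<in>B. u v *s v"
  have "inj_on ?f (B \<rightarrow>\<^sub>E UNIV)"
  proof (rule inj_onI)
    fix u w :: "'b \<Rightarrow> 'a"
    assume uw: "u \<in> B \<rightarrow>\<^sub>E UNIV" "w \<in> B \<rightarrow>\<^sub>E UNIV" "?f u = ?f w"
    then have "(\<Sum>v\<in>B. (u v - w v) *s v) = 0"
      by (simp add: scale_left_diff_distrib sum_subtractf)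
    then have "u v - w v = 0" if "v \<in> B" for v
      using independentD[OF assms(2,1) order_refl, of "\<lambda>v. u v - w v" v] that by simp
    then show "u = w"
      using uw by (intro PiE_ext[of u B _ w]) auto
  qed
  moreover have "?f ` (B \<rightarrow>\<^sub>E UNIV) = span B"
  proof -
    have "?f u \<in> ?f ` (B \<rightarrow>\<^sub>E UNIV)" for u
      by (rule image_eqI[of _ _ "restrict u B"]) auto
    then show ?thesis
      unfolding span_finite[OF assms(1)] by blast
  qed
  ultimately have "bij_betw ?f (B \<rightarrow>\<^sub>E UNIV) (span B)"
    by (simp add: bij_betw_def)
  from bij_betw_same_card[OF this] show ?thesis
    by (simp add: card_PiE assms(1))
qed

lemma (in vector_space) card_subspace:
  assumes "subspace U" "finite U"
  shows "card U = card (UNIV :: 'a set) ^ dim U"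
proof -
  obtain B where B: "B \<subseteq> U" "independent B" "U \<subseteq> span B" "card B = dim U"
    using basis_exists by blast
  then have "span B = U"
    using span_subspace assms(1) by blast
  then show ?thesis
    using card_span_independent[of B] B assms(2) finite_subset by metis
qed

section \<open>Coordinates, size and subspaces of V(n,q)\<close>

lemma CARD_ge_2: "CARD('f::{zero_neq_one,finite}) \<ge> 2"
proof -
  have "card {0, 1 :: 'f} \<le> CARD('f)"
    by (intro card_mono) auto
  then show ?thesis
    by simp
qed

lemma subspace_V: "fvec.subspace (V F n)"
  by (auto simp: fvec.subspace_def V_def vscale_def)

definition unit_vec :: "nat \<Rightarrow> nat \<Rightarrow> 'f::field" where
  "unit_vec i = (\<lambda>j. if j = i then 1 else 0)"

lemma inj_unit_vec: "inj unit_vec"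
  by (rule injI) (metis unit_vec_def zero_neq_one)

lemma sum_vscale_apply: "(\<Sum>x\<in>A. vscale (c x) (f x)) j = (\<Sum>x\<in>A. c x * f x j)"
  by (induction A rule: infinite_finite_induct) (simp_all add: vscale_def)

lemma V_expand:
  assumes "v \<in> V F n"
  shows "v = (\<Sum>i<n. vscale (v i) (unit_vec i))"
proof
  fix j
  have "(\<Sum>i<n. vscale (v i) (unit_vec i)) j = (\<Sum>i<n. if i = j then v i else 0)"
    unfolding sum_vscale_apply unit_vec_def by (intro sum.cong) auto
  also have "\<dots> = v j"
    using assms by (auto simp: V_def)
  finally show "v j = (\<Sum>i<n. vscale (v i) (unit_vec i)) j" ..
qed

lemma independent_unit_vec: "fvec.independent (unit_vec ` {..<n} :: (nat \<Rightarrow> 'f::field) set)"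
proof (rule fvec.independent_if_scalars_zero)
  fix f :: "(nat \<Rightarrow> 'f) \<Rightarrow> 'f" and x :: "nat \<Rightarrow> 'f"
  assume sum: "(\<Sum>x\<in>unit_vec ` {..<n}. vscale (f x) x) = 0" and "x \<in> unit_vec ` {..<n}"
  then obtain j where j: "j < n" "x = unit_vec j"
    by blast
  have "0 = (\<Sum>i<n. vscale (f (unit_vec i)) (unit_vec i)) j"
    using sum inj_unit_vec by (subst (asm) sum.reindex) (auto simp: inj_on_def)
  also have "\<dots> = (\<Sum>i<n. if i = j then f (unit_vec i) else 0)"
    unfolding sum_vscale_apply unit_vec_def by (intro sum.cong) auto
  also have "\<dots> = f x"
    using j by simp
  finally show "f x = 0" ..
qed simp

lemma unit_vec_in_V: "i < n \<Longrightarrow> unit_vec i \<in> V F n"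
  by (auto simp: unit_vec_def V_def)

lemma span_unit_vec: "fvec.span (unit_vec ` {..<n}) = V F n"
proof
  show "fvec.span (unit_vec ` {..<n}) \<subseteq> V F n"
    by (intro fvec.span_minimal subspace_V) (auto simp: unit_vec_in_V)
  show "V F n \<subseteq> fvec.span (unit_vec ` {..<n})"
  proof
    fix v
    assume "v \<in> V F n"
    moreover have "(\<Sum>i<n. vscale (v i) (unit_vec i)) \<in> fvec.span (unit_vec ` {..<n})"
      by (intro fvec.span_sum fvec.span_scale fvec.span_base) simp
    ultimately show "v \<in> fvec.span (unit_vec ` {..<n})"
      by (metis V_expand)
  qed
qed

lemma card_V: "card (V TYPE('f::{field,finite}) n) = CARD('f) ^ n"
proof -
  have "card (unit_vec ` {..<n} :: (nat \<Rightarrow> 'f) set) = n"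
    using inj_unit_vec by (metis card_image card_lessThan inj_on_subset subset_UNIV)
  then show ?thesis
    using fvec.card_span_independent[OF _ independent_unit_vec[of n, where 'f = 'f]]
      span_unit_vec[of n "TYPE('f)"] by simp
qed

lemma finite_V: "finite (V TYPE('f::{field,finite}) n)"
  by (rule card_ge_0_finite) (simp add: card_V)

text \<open>As q is at least 2, the size q^k determines the dimension k. Later membership proofs can
  therefore count elements instead of handling bases.\<close>

lemma mem_k_subspaces_iff:
  "U \<in> k_subspaces TYPE('f::{field,finite}) n k \<longleftrightarrow>
     U \<subseteq> V TYPE('f) n \<and> fvec.subspace U \<and> card U = CARD('f) ^ k"
proof -
  have "fvec.dim U = k \<longleftrightarrow> card U = CARD('f) ^ k" if "U \<subseteq> V TYPE('f) n" "fvec.subspace U"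
  proof -
    have "card U = CARD('f) ^ fvec.dim U"
      using that fvec.card_subspace finite_subset[OF _ finite_V] by blast
    then show ?thesis
      using CARD_ge_2[where 'f = 'f] by simp
  qed
  then show ?thesis
    unfolding k_subspaces_def by blast
qed

text \<open>\<open>ys\<close> holds vectors chosen earlier, to be extended by \<open>m\<close>
  vectors from \<open>U\<close>. Distinctness is demanded separately because independence of
  \<open>set (xs @ ys)\<close> does not see repetitions.\<close>

definition indep_lists ::
  "(nat \<Rightarrow> 'f::field) set \<Rightarrow> (nat \<Rightarrow> 'f) list \<Rightarrow> nat \<Rightarrow> (nat \<Rightarrow> 'f) list set" where
  "indep_lists U ys m =
     {xs. length xs = m \<and> set xs \<subseteq> U \<and> distinct (xs @ ys) \<and> fvec.independent (set (xs @ ys))}"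

lemma finite_indep_lists: "finite U \<Longrightarrow> finite (indep_lists U ys m)"
  by (rule finite_subset[OF _ finite_lists_length_eq[of U m]]) (auto simp: indep_lists_def)

lemma card_indep_lists:
  fixes U :: "(nat \<Rightarrow> 'f::{field,finite}) set"
  assumes U: "fvec.subspace U" "finite U"
    and ys: "set ys \<subseteq> U" "distinct ys" "fvec.independent (set ys)"
  shows "card (indep_lists U ys m) = (\<Prod>i<m. card U - CARD('f) ^ (length ys + i))"
proof (induction m)
  case 0
  have "indep_lists U ys 0 = {[]}"
    using ys by (auto simp: indep_lists_def)
  then show ?case
    by simp
next
  case (Suc m)
  \<comment> \<open>The admissible new heads for \<open>xs\<close>: the vectors outside the span of
    what is already chosen, a subspace of \<open>U\<close> with q^(length ys + m) elements.\<close>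
  define W where "W xs = U - fvec.span (set (xs @ ys))" for xs
  have W: "card (W xs) = card U - CARD('f) ^ (length ys + m)" if "xs \<in> indep_lists U ys m" for xs
  proof -
    have "card (set (xs @ ys)) = length ys + m"
      using that by (subst distinct_card) (auto simp: indep_lists_def)
    moreover have "fvec.span (set (xs @ ys)) \<subseteq> U"
      using that ys U by (intro fvec.span_minimal) (auto simp: indep_lists_def)
    ultimately show ?thesis
      using fvec.card_span_independent[of "set (xs @ ys)"] that U(2)
      by (simp add: W_def card_Diff_subset finite_subset indep_lists_def)
  qed
  have "indep_lists U ys (Suc m) = (\<lambda>(xs, x). x # xs) ` Sigma (indep_lists U ys m) W"
  proof (intro equalityI subsetI)
    fix zs
    assume zs: "zs \<in> indep_lists U ys (Suc m)"
    then obtain x xs where zs_eq: "zs = x # xs"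
      by (cases zs) (auto simp: indep_lists_def)
    have "xs \<in> indep_lists U ys m" "x \<in> W xs"
      using zs unfolding zs_eq by (auto simp: indep_lists_def W_def fvec.independent_insert)
    then show "zs \<in> (\<lambda>(xs, x). x # xs) ` Sigma (indep_lists U ys m) W"
      using zs_eq by force
  next
    fix zs
    assume "zs \<in> (\<lambda>(xs, x). x # xs) ` Sigma (indep_lists U ys m) W"
    then obtain xs x where *: "zs = x # xs" "xs \<in> indep_lists U ys m" "x \<in> W xs"
      by auto
    moreover from *(3) have "x \<notin> set (xs @ ys)"
      using fvec.span_base unfolding W_def by blast
    ultimately show "zs \<in> indep_lists U ys (Suc m)"
      by (auto simp: indep_lists_def W_def fvec.independent_insert)
  qed
  then have "card (indep_lists U ys (Suc m)) = card (Sigma (indep_lists U ys m) W)"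
    by (simp add: card_image inj_on_def)
  also have "\<dots> = (\<Sum>xs\<in>indep_lists U ys m. card (W xs))"
    by (rule card_SigmaI) (auto simp: finite_indep_lists U(2) W_def)
  also have "\<dots> = card (indep_lists U ys m) * (card U - CARD('f) ^ (length ys + m))"
    by (simp add: W)
  finally show ?case
    using Suc.IH by simp
qed

subsection \<open>Linear groups\<close>

lemma V_add: "x \<in> V F n \<Longrightarrow> y \<in> V F n \<Longrightarrow> x + y \<in> V F n"
  by (simp add: fvec.subspace_add subspace_V)

lemma V_scale: "x \<in> V F n \<Longrightarrow> vscale c x \<in> V F n"
  by (simp add: fvec.subspace_scale subspace_V)

lemma finite_GL: "finite (GL TYPE('f::{field,finite}) n)"
proof (rule finite_subset)
  show "GL TYPE('f) n \<subseteq> V TYPE('f) n \<rightarrow>\<^sub>E V TYPE('f) n"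
    by (auto simp: GL_def PiE_def bij_betw_def)
qed (simp add: finite_PiE finite_V)

text \<open>On the finite set V injectivity already gives bijectivity, and \<open>restrict\<close>
  supplies the extensionality built into \<open>GL\<close>.\<close>

lemma GL_I:
  fixes g :: "(nat \<Rightarrow> 'f::{field,finite}) \<Rightarrow> nat \<Rightarrow> 'f"
  assumes "\<And>v. v \<in> V TYPE('f) n \<Longrightarrow> g v \<in> V TYPE('f) n" "inj_on g (V TYPE('f) n)"
    and "\<And>x y. x \<in> V TYPE('f) n \<Longrightarrow> y \<in> V TYPE('f) n \<Longrightarrow> g (x + y) = g x + g y"
    and "\<And>c x. x \<in> V TYPE('f) n \<Longrightarrow> g (vscale c x) = vscale c (g x)"
  shows "restrict g (V TYPE('f) n) \<in> GL TYPE('f) n"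
proof -
  have "g ` V TYPE('f) n = V TYPE('f) n"
    using assms(1,2) by (intro endo_inj_surj finite_V) auto
  then have "bij_betw (restrict g (V TYPE('f) n)) (V TYPE('f) n) (V TYPE('f) n)"
    using assms(2) by (simp add: bij_betw_def inj_on_restrict_eq)
  then show ?thesis
    using assms(3,4) by (simp add: GL_def V_add V_scale)
qed

lemma GL_D:
  assumes "g \<in> GL F n"
  shows "g \<in> extensional (V F n)" "bij_betw g (V F n) (V F n)"
    "x \<in> V F n \<Longrightarrow> y \<in> V F n \<Longrightarrow> g (x + y) = g x + g y"
    "x \<in> V F n \<Longrightarrow> g (vscale c x) = vscale c (g x)"
    "inj_on g (V F n)" "x \<in> V F n \<Longrightarrow> g x \<in> V F n"
  using assms by (auto simp: GL_def bij_betw_def)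

lemma GL_0:
  assumes "g \<in> GL F n"
  shows "g 0 = 0"
  using GL_D(3)[OF assms, of 0 0] fvec.subspace_0[OF subspace_V[of F n]] by simp

text \<open>The linear map sending the i-th unit vector to \<open>b i\<close>. It is linear on the
  whole type \<open>nat \<Rightarrow> 'f\<close>, unlike the elements of \<open>GL\<close>, so the
  library theory of linear maps applies to it.\<close>

definition lin_of :: "nat \<Rightarrow> (nat \<Rightarrow> nat \<Rightarrow> 'f::field) \<Rightarrow> (nat \<Rightarrow> 'f) \<Rightarrow> nat \<Rightarrow> 'f" where
  "lin_of n b v = (\<Sum>i<n. vscale (v i) (b i))"

lemma vector_space_pair_vscale: "vector_space_pair vscale vscale"
  by unfold_locales

lemma linear_lin_of: "Vector_Spaces.linear vscale vscale (lin_of n b)"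
proof -
  have "lin_of n b (x + y) = lin_of n b x + lin_of n b y" for x y
    unfolding lin_of_def by (simp only: plus_fun_apply fvec.scale_left_distrib sum.distrib)
  moreover have "lin_of n b (vscale c x) = vscale c (lin_of n b x)" for c x
  proof -
    have "vscale (vscale c x i) (b i) = vscale c (vscale (x i) (b i))" for i
      by (simp add: vscale_def mult.assoc)
    then show ?thesis
      unfolding lin_of_def by (simp only: fvec.scale_sum_right)
  qed
  ultimately show ?thesis
    by (simp add: Vector_Spaces.linear_iff fvec.vector_space_axioms)
qed

lemma lin_of_unit_vec: "j < n \<Longrightarrow> lin_of n b (unit_vec j) = b j"
proof -
  assume "j < n"
  have "lin_of n b (unit_vec j) = (\<Sum>i<n. if i = j then b j else 0)"
    unfolding lin_of_def unit_vec_def by (intro sum.cong) auto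
  then show ?thesis
    using \<open>j < n\<close> by simp
qed

lemma lin_of_in_V: "(\<And>i. i < n \<Longrightarrow> b i \<in> V F m) \<Longrightarrow> lin_of n b v \<in> V F m"
  unfolding lin_of_def by (auto intro!: fvec.subspace_sum subspace_V fvec.subspace_scale)

text \<open>Replaces an element of \<open>GL\<close> on V by a totally defined linear map. The
  induction runs over partial sums of the coordinate expansion, all of which stay in V, where
  \<open>g\<close> is known to be linear.\<close>

lemma GL_eq_lin_of:
  assumes g: "g \<in> GL F n" and v: "v \<in> V F n"
  shows "g v = lin_of n (\<lambda>i. g (unit_vec i)) v"
proof -
  have "g (\<Sum>i\<in>A. vscale (v i) (unit_vec i)) = (\<Sum>i\<in>A. vscale (v i) (g (unit_vec i)))"
    if "A \<subseteq> {..<n}" for A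
    using finite_subset[OF that finite_lessThan] that
  proof (induction A rule: finite_induct)
    case empty
    then show ?case
      using GL_0[OF g] by (simp only: sum.empty)
  next
    case (insert a A)
    have "(\<Sum>i\<in>A. vscale (v i) (unit_vec i)) \<in> V F n"
      using insert.prems
      by (intro fvec.subspace_sum subspace_V fvec.subspace_scale unit_vec_in_V) auto
    moreover have "unit_vec a \<in> V F n"
      using insert.prems by (simp add: unit_vec_in_V)
    ultimately show ?case
      using insert by (simp only: sum.insert GL_D(3,4)[OF g] V_scale insert_subset simp_thms)
  qed
  from this[OF order_refl] show ?thesis
    using V_expand[OF v] by (simp add: lin_of_def)
qed

text \<open>An independent list of length m in V(m,q) serves as the images of the unit vectors, and
  different lists give different invertible maps. The inequality serves to bound such products from
  above by group orders.\<close>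

lemma card_GL_ge:
  "(\<Prod>i<m. CARD('f) ^ m - CARD('f) ^ i) \<le> card (GL TYPE('f::{field,finite}) m)"
proof -
  let ?V = "V TYPE('f) m"
  let ?L = "indep_lists ?V [] m"
  let ?f = "\<lambda>xs. restrict (lin_of m (\<lambda>i. xs ! i)) ?V"
  have card: "card ?L = (\<Prod>i<m. CARD('f) ^ m - CARD('f) ^ i)"
    by (subst card_indep_lists) (simp_all add: subspace_V finite_V card_V fvec.independent_empty)
  have "?f xs \<in> GL TYPE('f) m" if "xs \<in> ?L" for xs
  proof -
    have xs: "length xs = m" "set xs \<subseteq> ?V" "distinct xs" "fvec.independent (set xs)"
      using that by (auto simp: indep_lists_def)
    let ?g = "lin_of m (\<lambda>i. xs ! i)"
    interpret g: Vector_Spaces.linear vscale vscale ?g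
      by (rule linear_lin_of)
    have "?g ` unit_vec ` {..<m} = (\<lambda>i. xs ! i) ` {..<m}"
      unfolding image_image by (intro image_cong) (simp_all add: lin_of_unit_vec)
    also have "\<dots> = set xs"
      using xs(1) by (auto simp: set_conv_nth)
    finally have im: "?g ` unit_vec ` {..<m} = set xs" .
    have "inj_on ?g (unit_vec ` {..<m})"
      using xs by (auto simp: inj_on_def lin_of_unit_vec nth_eq_iff_index_eq)
    with xs(4) im have "inj_on ?g (fvec.span (unit_vec ` {..<m}))"
      by (intro g.inj_on_span_independent_image) simp_all
    then have "inj_on ?g ?V"
      by (simp only: span_unit_vec[of m "TYPE('f)"])
    then show ?thesis
      using xs by (intro GL_I) (auto simp: g.add g.scale intro!: lin_of_in_V)
  qed
  moreover have "inj_on ?f ?L"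
  proof (rule inj_onI)
    fix xs ys
    assume L: "xs \<in> ?L" "ys \<in> ?L" and eq: "?f xs = ?f ys"
    have "xs ! i = ys ! i" if "i < m" for i
      using fun_cong[OF eq, of "unit_vec i"] that by (simp add: unit_vec_in_V lin_of_unit_vec)
    then show "xs = ys"
      using L by (auto simp: indep_lists_def intro: nth_equalityI)
  qed
  ultimately show ?thesis
    unfolding card[symmetric] by (intro card_inj_on_le[of ?f] finite_GL) auto
qed

text \<open>Extend a basis \<open>A\<close> of \<open>U\<close> to a basis \<open>B\<close> of V. A
  map \<open>h\<close> is determined by its values on \<open>B\<close>; those on \<open>A\<close>
  form an independent k-list in \<open>W\<close>, and the others extend it to an independent n-list
  in V.\<close>

lemma card_GL_maps_to_le:
  fixes U W :: "(nat \<Rightarrow> 'f::{field,finite}) set"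
  assumes U: "U \<in> k_subspaces TYPE('f) n k" and W: "W \<in> k_subspaces TYPE('f) n k"
  shows "card {h \<in> GL TYPE('f) n. h ` U = W} \<le>
    (\<Prod>i<k. CARD('f) ^ k - CARD('f) ^ i) * (\<Prod>i<n - k. CARD('f) ^ n - CARD('f) ^ (k + i))"
proof -
  interpret vv: vector_space_pair vscale "vscale :: 'f \<Rightarrow> _"
    by (rule vector_space_pair_vscale)
  let ?V = "V TYPE('f) n"
  let ?M = "{h \<in> GL TYPE('f) n. h ` U = W}"
  have UV: "U \<subseteq> ?V" and WV: "W \<subseteq> ?V" and Wsub: "fvec.subspace W"
    and cardW: "card W = CARD('f) ^ k"
    using U W by (auto simp: mem_k_subspaces_iff)
  obtain A where A: "A \<subseteq> U" "fvec.independent A" "card A = k"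
    using U by (metis (mono_tags, lifting) fvec.basis_exists k_subspaces_def mem_Collect_eq)
  obtain B where B: "A \<subseteq> B" "B \<subseteq> ?V" "fvec.independent B" "?V \<subseteq> fvec.span B"
    using fvec.maximal_independent_subset_extend[of A ?V] A UV by blast
  have "finite B"
    using B(2) finite_V finite_subset by blast
  have span: "fvec.span B = ?V"
    using B fvec.span_subspace subspace_V by blast
  \<comment> \<open>The size of \<open>B\<close> is read off by counting its span in two
    ways.\<close>
  then have "CARD('f) ^ card B = CARD('f) ^ n"
    using fvec.card_span_independent[OF \<open>finite B\<close> B(3)] card_V[of n, where 'f = 'f] by simp
  then have cardB: "card B = n"
    using CARD_ge_2[where 'f = 'f] by simp
  obtain ys where ys: "set ys = A" "distinct ys"
    using finite_distinct_list[of A] finite_subset[OF B(1) \<open>finite B\<close>] by blast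
  obtain xs where xs: "set xs = B - A" "distinct xs"
    using finite_distinct_list[of "B - A"] \<open>finite B\<close> by blast
  have len: "length ys = k" "length xs = n - k"
    using ys xs A(3) cardB B(1) distinct_card[of ys] distinct_card[of xs]
      card_Diff_subset[of A B] finite_subset[OF B(1) \<open>finite B\<close>] by auto
  let ?S = "Sigma (indep_lists W [] k) (\<lambda>zs. indep_lists ?V zs (n - k))"
  let ?f = "\<lambda>h. (map h ys, map h xs)"
  have "?f ` ?M \<subseteq> ?S"
  proof (intro image_subsetI)
    fix h
    assume "h \<in> ?M"
    then have h: "h \<in> GL TYPE('f) n" "h ` U = W"
      by auto
    let ?H = "lin_of n (\<lambda>i. h (unit_vec i))"
    interpret H: Vector_Spaces.linear vscale vscale ?H
      by (rule linear_lin_of)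
    have hH: "h v = ?H v" if "v \<in> ?V" for v
      using GL_eq_lin_of[OF h(1) that] .
    have "inj_on ?H ?V"
      using GL_D(5)[OF h(1)] hH by (simp add: inj_on_def)
    then have "fvec.independent (?H ` B)"
      using H.independent_injective_image[OF B(3)] span by simp
    moreover have "?H ` B = h ` B"
      using hH B(2) by (intro image_cong) auto
    ultimately have ind: "fvec.independent (h ` B)"
      by simp
    then have indA: "fvec.independent (h ` A)"
      using B(1) by (meson fvec.independent_mono image_mono)
    have inj: "inj_on h B"
      using GL_D(5)[OF h(1)] B(2) by (rule inj_on_subset)
    then have injA: "inj_on h A"
      using B(1) by (rule inj_on_subset)
    have "map h ys \<in> indep_lists W [] k"
      using ys len indA injA A(1) h(2) by (auto simp: indep_lists_def distinct_map)
    moreover have "map h xs \<in> indep_lists ?V (map h ys) (n - k)"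
    proof -
      have un: "h ` (B - A) \<union> h ` A = h ` B"
        using B(1) by blast
      have "distinct (map h (xs @ ys))"
        unfolding distinct_map using xs ys inj B(1) by (auto simp: Un_absorb2)
      moreover have "h ` (B - A) \<subseteq> ?V"
        using GL_D(6)[OF h(1)] B(2) by blast
      ultimately show ?thesis
        using xs ys len ind un by (simp add: indep_lists_def)
    qed
    ultimately show "?f h \<in> ?S"
      by simp
  qed
  moreover have "inj_on ?f ?M"
  proof (rule inj_onI)
    fix h1 h2
    assume h: "h1 \<in> ?M" "h2 \<in> ?M" and eq: "?f h1 = ?f h2"
    have eqB: "h1 b = h2 b" if "b \<in> B" for b
      using eq that xs ys by (cases "b \<in> A") auto
    let ?H1 = "lin_of n (\<lambda>i. h1 (unit_vec i))" and ?H2 = "lin_of n (\<lambda>i. h2 (unit_vec i))"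
    have H: "h1 v = ?H1 v" "h2 v = ?H2 v" if "v \<in> ?V" for v
      using GL_eq_lin_of that h by blast+
    have "h1 v = h2 v" if "v \<in> ?V" for v
    proof -
      have "?H1 v = ?H2 v"
      proof (rule vv.linear_eq_on[OF linear_lin_of linear_lin_of])
        show "v \<in> fvec.span B"
          using that span by simp
        show "?H1 b = ?H2 b" if "b \<in> B" for b
          using H[of b] eqB[OF that] that B(2) by auto
      qed
      then show ?thesis
        using H[OF that] by simp
    qed
    then show "h1 = h2"
      using h GL_D(1) by (intro extensionalityI[of h1 ?V h2]) auto
  qed
  moreover have fin: "finite W"
    using WV finite_V finite_subset by blast
  ultimately have "card ?M \<le> card ?S"
    by (intro card_inj_on_le[of ?f]) (auto intro!: finite_SigmaI finite_indep_lists finite_V)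
  also have "card ?S = (\<Sum>zs\<in>indep_lists W [] k. card (indep_lists ?V zs (n - k)))"
    using fin by (intro card_SigmaI) (auto intro!: finite_indep_lists finite_V)
  also have "\<dots> = (\<Sum>zs\<in>indep_lists W [] k.
      (\<Prod>i<n - k. CARD('f) ^ n - CARD('f) ^ (k + i)))"
  proof (rule sum.cong[OF refl])
    fix zs
    assume "zs \<in> indep_lists W [] k"
    then have "set zs \<subseteq> ?V" "distinct zs" "fvec.independent (set zs)" "length zs = k"
      using WV by (auto simp: indep_lists_def)
    then show "card (indep_lists ?V zs (n - k)) =
        (\<Prod>i<n - k. CARD('f) ^ n - CARD('f) ^ (k + i))"
      by (simp add: card_indep_lists subspace_V finite_V card_V)
  qed
  also have "\<dots> = card (indep_lists W [] k) *
      (\<Prod>i<n - k. CARD('f) ^ n - CARD('f) ^ (k + i))"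
    by simp
  also have "card (indep_lists W [] k) = (\<Prod>i<k. CARD('f) ^ k - CARD('f) ^ i)"
    by (subst card_indep_lists) (simp_all add: Wsub fin cardW fvec.independent_empty)
  finally show ?thesis .
qed

lemma card_GL_maps_to_le_GL:
  fixes U W :: "(nat \<Rightarrow> 'f::{field,finite}) set"
  assumes "U \<in> k_subspaces TYPE('f) n k" "W \<in> k_subspaces TYPE('f) n k" "k \<le> n"
  shows "card {h \<in> GL TYPE('f) n. h ` U = W} \<le>
    CARD('f) ^ (k * (n - k)) * card (GL TYPE('f) k) * card (GL TYPE('f) (n - k))"
proof -
  let ?q = "CARD('f)"
  \<comment> \<open>Taking q^k out of each of the n - k factors produces the power q^(k(n-k)) and
    leaves the product for dimension n - k.\<close>
  have "(\<Prod>i<n - k. ?q ^ n - ?q ^ (k + i)) = (\<Prod>i<n - k. ?q ^ k * (?q ^ (n - k) - ?q ^ i))"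
    using assms(3) by (intro prod.cong) (simp_all add: diff_mult_distrib2 flip: power_add)
  also have "\<dots> = ?q ^ (k * (n - k)) * (\<Prod>i<n - k. ?q ^ (n - k) - ?q ^ i)"
    by (simp add: prod.distrib power_mult)
  finally have "card {h \<in> GL TYPE('f) n. h ` U = W} \<le>
      (\<Prod>i<k. ?q ^ k - ?q ^ i) * (?q ^ (k * (n - k)) * (\<Prod>i<n - k. ?q ^ (n - k) - ?q ^ i))"
    using card_GL_maps_to_le[OF assms(1,2)] by simp
  also have "\<dots> \<le> card (GL TYPE('f) k) * (?q ^ (k * (n - k)) * card (GL TYPE('f) (n - k)))"
    by (intro mult_mono card_GL_ge) auto
  finally show ?thesis
    by (simp add: mult_ac)
qed

subsection \<open>The Desarguesian spread\<close>

text \<open>Makes the algebraic closure a vector space over \<open>'f\<close>, so that the fields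
  GF(q^m) inside it become subspaces.\<close>

definition ac_scale :: "'f::field \<Rightarrow> 'f alg_closure \<Rightarrow> 'f alg_closure" where
  "ac_scale c x = to_ac c * x"

interpretation acv: vector_space ac_scale
  by unfold_locales (simp_all add: ac_scale_def algebra_simps)

text \<open>GF(q^m) contains the scalars because they satisfy c^q = c, and it is closed under sums
  because q^m is a power of the characteristic. Its dimension follows from its size.\<close>

lemma frob_fixed_subspace:
  fixes m :: nat
  assumes "primepow CARD('f::{field,finite})" "0 < m"
  defines "E \<equiv> frob_fixed (CARD('f) ^ m) :: 'f alg_closure set"
  shows "acv.subspace E" "card E = CARD('f) ^ m" "finite E" "acv.dim E = m"
proof -
  obtain j where j: "Factorial_Ring.prime CHAR('f)" "j > 0" "CARD('f) = CHAR('f) ^ j"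
    using CARD_eq_CHAR_power[OF assms(1)] .
  have p: "Factorial_Ring.prime CHAR('f alg_closure)" "CARD('f) ^ m = CHAR('f alg_closure) ^ (j * m)"
    using j by (simp_all add: power_mult)
  have scal: "to_ac c \<in> E" for c
    unfolding E_def
    by (rule frob_fixed_power)
      (simp add: frob_fixed_def finite_field_power_card flip: to_ac_power)
  show sub: "acv.subspace E"
    unfolding acv.subspace_def
  proof (intro conjI ballI allI)
    show "0 \<in> E"
      unfolding E_def by (rule frob_fixed_0) simp
    show "x + y \<in> E" if "x \<in> E" "y \<in> E" for x y
      using frob_fixed_add[OF p] that by (simp add: E_def)
    show "ac_scale c x \<in> E" if "x \<in> E" for c x
      unfolding ac_scale_def using frob_fixed_mult scal that unfolding E_def by blast
  qed
  have "of_nat (CARD('f) ^ m) = (0 :: 'f alg_closure)"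
    unfolding p(2) of_nat_power of_nat_CHAR using j(2) assms(2) by simp
  moreover have q: "2 \<le> CARD('f)"
    by (rule CARD_ge_2)
  then have "1 < CARD('f) ^ m"
    using assms(2) by (intro one_less_power) auto
  ultimately show card: "card E = CARD('f) ^ m"
    unfolding E_def by (rule card_frob_fixed)
  show fin: "finite E"
    by (rule card_ge_0_finite) (simp add: card)
  show "acv.dim E = m"
    using acv.card_subspace[OF sub fin] card q by simp
qed

lemma dim_V: "fvec.dim (V TYPE('f::{field,finite}) n) = n"
  using fvec.card_subspace[of "V TYPE('f) n"] CARD_ge_2[where 'f = 'f]
  by (simp add: card_V subspace_V finite_V)

text \<open>Both spaces have dimension n over \<open>'f\<close>. The isomorphism transports the
  multiplication of GF(q^n) to V(n,q).\<close>

lemma ex_linear_iso_frob_fixed: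
  assumes "primepow CARD('f::{field,finite})" "0 < n"
  obtains f where "Vector_Spaces.linear ac_scale vscale f"
    "f ` frob_fixed (CARD('f) ^ n) = V TYPE('f) n" "inj_on f (frob_fixed (CARD('f) ^ n))"
proof -
  let ?E = "frob_fixed (CARD('f) ^ n) :: 'f alg_closure set"
  note E = frob_fixed_subspace[OF assms]
  interpret vp: vector_space_pair "ac_scale :: 'f \<Rightarrow> _" vscale
    by unfold_locales
  obtain B where B: "B \<subseteq> ?E" "acv.independent B" "?E \<subseteq> acv.span B" "card B = acv.dim ?E"
    using acv.basis_exists .
  obtain C where C: "C \<subseteq> V TYPE('f) n" "fvec.independent C" "V TYPE('f) n \<subseteq> fvec.span C"
    "card C = fvec.dim (V TYPE('f) n)"
    using fvec.basis_exists .
  have "finite B" "finite C"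
    using B(1) C(1) E(3) finite_V finite_subset by blast+
  then show thesis
    using vp.finite_basis_to_basis_subspace_isomorphism[OF E(1) subspace_V _ _ B _ C] that
    by (auto simp: E(4) dim_V)
qed

text \<open>
  The Desarguesian spread: the one-dimensional subspaces of \<open>GF(q^n)\<close> over its subfield
  \<open>GF(q^k)\<close>. Each multiplication by a nonzero element of \<open>GF(q^n)\<close> permutes them.
\<close>

lemma ex_spread_with_stabilizer:
  assumes "primepow CARD('f::{field,finite})" "0 < k" "0 < n" "k dvd n"
  obtains S Z where "k_spread TYPE('f) n k S" "Z \<subseteq> GL TYPE('f) n"
    "card Z = CARD('f) ^ n - 1" "\<And>z. z \<in> Z \<Longrightarrow> (`) z ` S = S"
proof -
  define E where "E = (frob_fixed (CARD('f) ^ n) :: 'f alg_closure set)"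
  define K where "K = (frob_fixed (CARD('f) ^ k) :: 'f alg_closure set)"
  let ?V = "V TYPE('f) n"
  note E = frob_fixed_subspace[OF assms(1,3), folded E_def]
  note K = frob_fixed_subspace[OF assms(1,2), folded K_def]
  obtain f where f: "Vector_Spaces.linear ac_scale vscale f" "f ` E = ?V" "inj_on f E"
    using ex_linear_iso_frob_fixed[OF assms(1,3)] unfolding E_def .
  interpret f: Vector_Spaces.linear ac_scale vscale f
    by (rule f(1))
  define g where "g = the_inv_into E f"
  have g: "g v \<in> E" "f (g v) = v" if "v \<in> ?V" for v
    using that f(2,3) the_inv_into_into[OF f(3) _ order_refl] f_the_inv_into_f[OF f(3)]
    by (auto simp: g_def)
  have gf: "g (f x) = x" if "x \<in> E" for x
    using that f(3) by (simp add: g_def the_inv_into_f_f)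
  have fE: "f x \<in> ?V" if "x \<in> E" for x
    using f(2) that by blast
  have mult: "x * y \<in> E" if "x \<in> E" "y \<in> E" for x y
    using that unfolding E_def by (rule frob_fixed_mult)
  have KE: "K \<subseteq> E"
  proof -
    obtain t where "n = k * t"
      using assms(4) by (rule dvdE)
    then show ?thesis
      using frob_fixed_power[of _ "CARD('f) ^ k" t] by (auto simp: K_def E_def simp flip: power_mult)
  qed
  \<comment> \<open>\<open>L a\<close> is multiplication by \<open>a\<close> carried over to V, an
    element of the Singer cycle when \<open>a\<close> is nonzero; \<open>U a\<close> is the image of
    the \<open>K\<close>-line through \<open>a\<close>.\<close>
  define L where "L a = restrict (\<lambda>v. f (a * g v)) ?V" for a
  define U where "U a = f ` ((*) a ` K)" for a
  have aK: "(*) a ` K \<subseteq> E" if "a \<in> E" for a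
    using that KE mult by blast
  have g_add: "g (x + y) = g x + g y" if "x \<in> ?V" "y \<in> ?V" for x y
  proof -
    have "x + y = f (g x + g y)"
      using that by (simp add: f.add g)
    then show ?thesis
      using gf[of "g x + g y"] g that E(1) by (simp only: acv.subspace_add)
  qed
  have g_scale: "g (vscale c x) = ac_scale c (g x)" if "x \<in> ?V" for c x
  proof -
    have "vscale c x = f (ac_scale c (g x))"
      using that by (simp add: f.scale g)
    then show ?thesis
      using gf[of "ac_scale c (g x)"] g that E(1) by (simp only: acv.subspace_scale)
  qed
  have L_GL: "L a \<in> GL TYPE('f) n" if a: "a \<in> E - {0}" for a
    unfolding L_def
  proof (rule GL_I)
    fix v assume v: "v \<in> ?V"
    then show "f (a * g v) \<in> ?V"
      using a g by (intro fE mult) auto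
    show "f (a * g (vscale c v)) = vscale c (f (a * g v))" for c
      using g_scale[OF v] by (simp add: ac_scale_def mult.left_commute flip: f.scale)
    show "f (a * g (v + w)) = f (a * g v) + f (a * g w)" if "w \<in> ?V" for w
      using g_add[OF v that] by (simp only: distrib_left f.add)
  next
    show "inj_on (\<lambda>v. f (a * g v)) ?V"
    proof (rule inj_onI)
      fix v w assume vw: "v \<in> ?V" "w \<in> ?V" "f (a * g v) = f (a * g w)"
      moreover from vw have "a * g v \<in> E" "a * g w \<in> E"
        using a g by (auto intro: mult)
      ultimately have "a * g v = a * g w"
        using inj_onD[OF f(3)] by blast
      then show "v = w"
        using a vw(1,2) g(2) by (metis DiffD2 mult_cancel_left singleton_iff)
    qed
  qed
  \<comment> \<open>The value of \<open>L a\<close> at \<open>f 1\<close> is \<open>f a\<close>,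
    which determines \<open>a\<close>.\<close>
  have "inj_on L (E - {0})"
  proof (rule inj_onI)
    fix a b assume ab: "a \<in> E - {0}" "b \<in> E - {0}" "L a = L b"
    have 1: "1 \<in> E"
      unfolding E_def by (rule frob_fixed_1)
    have "f a = f b"
      using fun_cong[OF ab(3), of "f 1"] fE[OF 1] gf[OF 1] by (simp add: L_def)
    then show "a = b"
      using ab inj_onD[OF f(3)] by blast
  qed
  moreover have "0 \<in> E"
    using E(1) acv.subspace_0 by blast
  ultimately have card_Z: "card (L ` (E - {0})) = CARD('f) ^ n - 1"
    using E by (simp add: card_image card_Diff_singleton)
  have LU: "L a ` U b = U (a * b)" if "a \<in> E - {0}" "b \<in> E - {0}" for a b
  proof -
    have "L a ` U b = (\<lambda>x. L a (f (b * x))) ` K"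
      by (simp add: U_def image_image)
    also have "\<dots> = (\<lambda>x. f (a * b * x)) ` K"
    proof (rule image_cong[OF refl])
      fix x assume "x \<in> K"
      then have "b * x \<in> E"
        using KE mult that by blast
      then show "L a (f (b * x)) = f (a * b * x)"
        by (simp add: L_def fE gf mult.assoc)
    qed
    finally show ?thesis
      by (simp add: U_def image_image)
  qed
  define S where "S = U ` (E - {0})"
  have "k_spread TYPE('f) n k S"
    unfolding k_spread_def
  proof (intro conjI ballI subsetI)
    fix W assume "W \<in> S"
    then obtain a where a: "a \<in> E" "a \<noteq> 0" "W = U a"
      by (auto simp: S_def)
    have "acv.subspace ((*) a ` K)"
      unfolding acv.subspace_def
    proof (intro conjI ballI allI)
      show "0 \<in> (*) a ` K"
        using acv.subspace_0[OF K(1)] by (force intro: image_eqI[of _ _ 0])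
      show "x + y \<in> (*) a ` K" if "x \<in> (*) a ` K" "y \<in> (*) a ` K" for x y
        using that acv.subspace_add[OF K(1)] by (auto simp flip: distrib_left)
      show "ac_scale c x \<in> (*) a ` K" if "x \<in> (*) a ` K" for c x
        using that acv.subspace_scale[OF K(1)]
        by (auto simp: ac_scale_def mult.left_commute[of _ a])
    qed
    then have "fvec.subspace W"
      unfolding a(3) U_def by (rule f.subspace_image)
    moreover have "card W = CARD('f) ^ k"
    proof -
      have "inj_on f ((*) a ` K)"
        using f(3) aK[OF a(1)] by (rule inj_on_subset)
      moreover have "inj_on ((*) a) K"
        using a(2) by (simp add: inj_on_def)
      ultimately show ?thesis
        unfolding a(3) U_def by (simp add: card_image K(2))
    qed
    moreover have "W \<subseteq> ?V"
      unfolding a(3) U_def using aK[OF a(1)] fE by blast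
    ultimately show "W \<in> k_subspaces TYPE('f) n k"
      by (simp add: mem_k_subspaces_iff)
  next
    fix v assume v: "v \<in> ?V - {0}"
    then have gv: "g v \<in> E - {0}" "f (g v) = v"
      using g[of v] f.zero by auto
    have 1: "1 \<in> K"
      unfolding K_def by (rule frob_fixed_1)
    show "\<exists>!W. W \<in> S \<and> v \<in> W"
    proof (rule ex1I[of _ "U (g v)"])
      show "U (g v) \<in> S \<and> v \<in> U (g v)"
        using gv 1 unfolding S_def U_def by (force intro: image_eqI[of _ _ 1])
    next
      fix W assume W: "W \<in> S \<and> v \<in> W"
      then obtain a where a: "a \<in> E - {0}" "W = U a"
        by (auto simp: S_def)
      with W obtain c where c: "c \<in> K" "v = f (a * c)"
        by (auto simp: U_def)
      have "g v = a * c"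
        unfolding c(2) using a(1) c(1) KE by (intro gf mult) auto
      then have "c \<noteq> 0"
        using gv by auto
      \<comment> \<open>A nonzero \<open>c\<close> of the subfield \<open>K\<close> satisfies cK =
        K, so the line through a product ac is the line through \<open>a\<close>.\<close>
      have "(*) c ` K = K"
      proof (intro equalityI subsetI)
        fix x assume "x \<in> (*) c ` K"
        then show "x \<in> K"
          using c(1) unfolding K_def by (auto intro: frob_fixed_mult)
      next
        fix x assume "x \<in> K"
        then have "inverse c * x \<in> K"
          using c(1) unfolding K_def by (intro frob_fixed_mult frob_fixed_inverse)
        then show "x \<in> (*) c ` K"
          using \<open>c \<noteq> 0\<close> by (intro image_eqI[of _ _ "inverse c * x"]) auto
      qed
      then have "U (g v) = U a"
        unfolding \<open>g v = a * c\<close> U_def by (metis (no_types, lifting) image_cong image_image mult.assoc)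
      then show "W = U (g v)"
        using a(2) by simp
    qed
  qed
  moreover have "(`) z ` S = S" if z: "z \<in> L ` (E - {0})" for z
  proof -
    obtain a where a: "a \<in> E - {0}" "z = L a"
      using z by blast
    have "(`) z ` S = U ` (*) a ` (E - {0})"
      unfolding S_def a(2) image_image using LU[OF a(1)] by (intro image_cong) auto
    \<comment> \<open>Multiplication by a nonzero \<open>a\<close> is an injective self-map of the
      finite set \<open>E - {0}\<close>, hence onto.\<close>
    also have "(*) a ` (E - {0}) = E - {0}"
      using a E(3) by (intro endo_inj_surj) (auto simp: inj_on_def intro: mult)
    finally show ?thesis
      by (simp add: S_def)
  qed
  ultimately show thesis
    using that[of S "L ` (E - {0})"] L_GL card_Z by blast
qed

subsection \<open>Translates of a spread\<close>

lemma GL_compose: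
  assumes "g \<in> GL TYPE('f::{field,finite}) n" "h \<in> GL TYPE('f) n"
  shows "compose (V TYPE('f) n) g h \<in> GL TYPE('f) n"
  unfolding compose_def
proof (rule GL_I)
  show "inj_on (\<lambda>x. g (h x)) (V TYPE('f) n)"
    using inj_onD[OF GL_D(5)[OF assms(1)] _ GL_D(6)[OF assms(2)] GL_D(6)[OF assms(2)]]
      inj_onD[OF GL_D(5)[OF assms(2)]] by (intro inj_onI) blast
next
  fix x assume x: "x \<in> V TYPE('f) n"
  note hx = GL_D(6)[OF assms(2) x]
  show "g (h x) \<in> V TYPE('f) n"
    using hx by (rule GL_D(6)[OF assms(1)])
  show "g (h (vscale c x)) = vscale c (g (h x))" for c
    unfolding GL_D(4)[OF assms(2) x] by (rule GL_D(4)[OF assms(1) hx])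
  show "g (h (x + y)) = g (h x) + g (h y)" if y: "y \<in> V TYPE('f) n" for y
    unfolding GL_D(3)[OF assms(2) x y] by (rule GL_D(3)[OF assms(1) hx GL_D(6)[OF assms(2) y]])
qed

lemma GL_image_k_subspaces:
  fixes U :: "(nat \<Rightarrow> 'f::{field,finite}) set"
  assumes g: "g \<in> GL TYPE('f) n" and U: "U \<in> k_subspaces TYPE('f) n k"
  shows "g ` U \<in> k_subspaces TYPE('f) n k"
proof -
  note UV = U[unfolded mem_k_subspaces_iff]
  have "fvec.subspace (g ` U)"
    unfolding fvec.subspace_def
  proof (intro conjI ballI allI)
    show "0 \<in> g ` U"
      using GL_0[OF g] fvec.subspace_0 UV by (metis image_eqI)
    show "x + y \<in> g ` U" if xy: "x \<in> g ` U" "y \<in> g ` U" for x y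
    proof -
      obtain a b where ab: "a \<in> U" "b \<in> U" "x = g a" "y = g b"
        using xy by blast
      then have "x + y = g (a + b)"
        using UV GL_D(3)[OF g, of a b] by (metis subsetD)
      then show ?thesis
        using ab UV fvec.subspace_add by blast
    qed
    show "vscale c x \<in> g ` U" if x: "x \<in> g ` U" for c x
    proof -
      obtain a where a: "a \<in> U" "x = g a"
        using x by blast
      then have "vscale c x = g (vscale c a)"
        using UV GL_D(4)[OF g, of a c] by (metis subsetD)
      then show ?thesis
        using a UV fvec.subspace_scale by blast
    qed
  qed
  moreover have "card (g ` U) = card U"
    using inj_on_subset[OF GL_D(5)[OF g]] UV by (intro card_image) blast
  ultimately show ?thesis
    using UV GL_D(6)[OF g] by (auto simp: mem_k_subspaces_iff)
qed

lemma k_spread_image: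
  fixes S :: "(nat \<Rightarrow> 'f::{field,finite}) set set"
  assumes g: "g \<in> GL TYPE('f) n" and S: "k_spread TYPE('f) n k S"
  shows "k_spread TYPE('f) n k ((`) g ` S)"
  unfolding k_spread_def
proof (intro conjI ballI)
  show "(`) g ` S \<subseteq> k_subspaces TYPE('f) n k"
    using S GL_image_k_subspaces[OF g] by (auto simp: k_spread_def)
  fix v
  assume v: "v \<in> V TYPE('f) n - {0}"
  have SV: "U \<subseteq> V TYPE('f) n" if "U \<in> S" for U
    using S that by (auto simp: k_spread_def k_subspaces_def)
  obtain w where w: "w \<in> V TYPE('f) n" "v = g w"
    using v GL_D(2)[OF g] by (auto simp: bij_betw_def)
  with v GL_0[OF g] have "w \<noteq> 0"
    by auto
  with S w(1) have ex1: "\<exists>!U. U \<in> S \<and> w \<in> U"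
    by (auto simp: k_spread_def)
  have mem: "v \<in> g ` U \<longleftrightarrow> w \<in> U" if "U \<in> S" for U
    unfolding w(2) using inj_on_image_mem_iff[OF GL_D(5)[OF g] w(1) SV[OF that]] .
  from ex1 obtain U where U: "U \<in> S" "w \<in> U" "\<And>W. W \<in> S \<Longrightarrow> w \<in> W \<Longrightarrow> W = U"
    by blast
  show "\<exists>!U. U \<in> (`) g ` S \<and> v \<in> U"
  proof (rule ex1I[of _ "g ` U"])
    show "g ` U \<in> (`) g ` S \<and> v \<in> g ` U"
      using U(1,2) mem by blast
    show "A = g ` U" if A: "A \<in> (`) g ` S \<and> v \<in> A" for A
    proof -
      obtain W where "W \<in> S" "A = g ` W"
        using A by blast
      then show ?thesis
        using A U(3) mem by simp
    qed
  qed
qed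

lemma k_spread_finite:
  "k_spread TYPE('f::{field,finite}) n k S \<Longrightarrow> finite S"
  by (rule finite_subset[of _ "Pow (V TYPE('f) n)"])
    (auto simp: k_spread_def k_subspaces_def finite_V)

text \<open>The members of the spread, with 0 removed, partition the nonzero vectors into sets of
  size q^k - 1.\<close>

lemma card_k_spread:
  assumes S: "k_spread TYPE('f::{field,finite}) n k S"
  shows "card S * (CARD('f) ^ k - 1) = CARD('f) ^ n - 1"
proof -
  have U: "U \<subseteq> V TYPE('f) n" "0 \<in> U" "card U = CARD('f) ^ k" "finite U" if "U \<in> S" for U
  proof -
    have "U \<in> k_subspaces TYPE('f) n k"
      using S that by (auto simp: k_spread_def)
    then show "U \<subseteq> V TYPE('f) n" "0 \<in> U" "card U = CARD('f) ^ k" "finite U"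
      using fvec.subspace_0 finite_subset[OF _ finite_V] by (auto simp: mem_k_subspaces_iff)
  qed
  have ex1: "\<exists>!U. U \<in> S \<and> v \<in> U" if "v \<in> V TYPE('f) n - {0}" for v
    using S that by (auto simp: k_spread_def)
  have "V TYPE('f) n - {0} \<subseteq> (\<Union>U\<in>S. U - {0})"
  proof
    fix v assume v: "v \<in> V TYPE('f) n - {0}"
    then show "v \<in> (\<Union>U\<in>S. U - {0})"
      using ex1[OF v] by auto
  qed
  moreover have "(\<Union>U\<in>S. U - {0}) \<subseteq> V TYPE('f) n - {0}"
    using U(1) by auto
  ultimately have "card (V TYPE('f) n - {0}) = card (\<Union>U\<in>S. U - {0})"
    by (metis subset_antisym)
  also have "\<dots> = (\<Sum>U\<in>S. card (U - {0}))"
  proof (rule card_UN_disjoint)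
    show "\<forall>U\<in>S. \<forall>W\<in>S. U \<noteq> W \<longrightarrow> (U - {0}) \<inter> (W - {0}) = {}"
    proof (intro ballI impI equals0I)
      fix U W v
      assume UW: "U \<in> S" "W \<in> S" "U \<noteq> W" and v: "v \<in> (U - {0}) \<inter> (W - {0})"
      then have "v \<in> V TYPE('f) n - {0}"
        using U(1) by auto
      from ex1[OF this] UW v show False
        by auto
    qed
  qed (use U(4) k_spread_finite[OF S] in auto)
  also have "\<dots> = (\<Sum>U\<in>S. CARD('f) ^ k - 1)"
    using U by (intro sum.cong) (simp_all add: card_Diff_singleton)
  finally have "card (V TYPE('f) n - {0}) = card S * (CARD('f) ^ k - 1)"
    by simp
  then show ?thesis
    using fvec.subspace_0[OF subspace_V[of "TYPE('f)" n]]
    by (simp only: card_Diff_singleton card_V)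
qed

text \<open>Take \<open>T\<close> maximal for inclusion. Every element of \<open>G\<close> is
  related to a member of \<open>T\<close>, for otherwise it could be added; so at most
  \<open>card T\<close> neighbourhoods of size at most \<open>d\<close> cover \<open>G\<close>. By
  reflexivity each neighbourhood includes its own centre.\<close>

lemma ex_large_independent_set:
  assumes "finite G" and refl: "\<And>g. g \<in> G \<Longrightarrow> R g g"
    and sym: "\<And>g h. R g h \<Longrightarrow> R h g"
    and deg: "\<And>g. g \<in> G \<Longrightarrow> card {h \<in> G. R g h} \<le> d"
  obtains T where "T \<subseteq> G" "\<And>g h. g \<in> T \<Longrightarrow> h \<in> T \<Longrightarrow> g \<noteq> h \<Longrightarrow> \<not> R g h"
    "card G \<le> card T * d"
proof -
  define A where "A = {T. T \<subseteq> G \<and> (\<forall>g\<in>T. \<forall>h\<in>T. g \<noteq> h \<longrightarrow> \<not> R g h)}"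
  have "finite A"
    by (rule finite_subset[of _ "Pow G"]) (auto simp: A_def assms(1))
  moreover have "{} \<in> A"
    by (auto simp: A_def)
  ultimately obtain T where T: "T \<in> A" and max: "\<And>T'. T' \<in> A \<Longrightarrow> T \<subseteq> T' \<Longrightarrow> T = T'"
    using finite_has_maximal[of A] by blast
  have TG: "T \<subseteq> G"
    using T by (auto simp: A_def)
  have "\<exists>g\<in>T. R g h" if "h \<in> G" for h
  proof (rule ccontr)
    assume "\<not> (\<exists>g\<in>T. R g h)"
    then have "insert h T \<in> A"
      using T that sym unfolding A_def by blast
    then have "h \<in> T"
      using max[of "insert h T"] by blast
    then show False
      using \<open>\<not> (\<exists>g\<in>T. R g h)\<close> refl[OF that] by blast
  qed
  then have "G \<subseteq> (\<Union>g\<in>T. {h \<in> G. R g h})"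
    by blast
  moreover have "finite (\<Union>g\<in>T. {h \<in> G. R g h})"
    by (rule finite_subset[OF _ assms(1)]) blast
  ultimately have "card G \<le> card (\<Union>g\<in>T. {h \<in> G. R g h})"
    by (intro card_mono)
  also have "\<dots> \<le> (\<Sum>g\<in>T. card {h \<in> G. R g h})"
    using TG assms(1) finite_subset by (intro card_UN_le) blast
  also have "\<dots> \<le> card T * d"
    using sum_bounded_above[of T "\<lambda>g. card {h \<in> G. R g h}" d] deg TG by auto
  finally show thesis
    using that T by (auto simp: A_def)
qed

text \<open>Double counting of triples (h, U, W) with hU = gW. Every \<open>h\<close> whose
  translate meets that of \<open>g\<close> contributes at least one pair, and every h = gz with z in
  \<open>Z\<close> at least \<open>card S\<close> pairs. The correction stands on the left as a
  summand, which avoids truncated subtraction from the main term.\<close>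

lemma card_meeting_translates:
  fixes S :: "(nat \<Rightarrow> 'f::{field,finite}) set set"
  assumes S: "k_spread TYPE('f) n k S" "S \<noteq> {}" and "k \<le> n"
    and Z: "Z \<subseteq> GL TYPE('f) n" "\<And>z. z \<in> Z \<Longrightarrow> (`) z ` S = S"
    and g: "g \<in> GL TYPE('f) n"
  shows "card {h \<in> GL TYPE('f) n. (`) g ` S \<inter> (`) h ` S \<noteq> {}} + card Z * (card S - 1) \<le>
    (card S)\<^sup>2 * (CARD('f) ^ (k * (n - k)) * card (GL TYPE('f) k) * card (GL TYPE('f) (n - k)))"
proof -
  let ?G = "GL TYPE('f) n" and ?V = "V TYPE('f) n"
  define M where "M = {h \<in> ?G. (`) g ` S \<inter> (`) h ` S \<noteq> {}}"
  define Q where "Q h = {p \<in> S \<times> S. h ` fst p = g ` snd p}" for h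
  define gZ where "gZ = compose ?V g ` Z"
  have fS: "finite S"
    using S(1) by (rule k_spread_finite)
  have fQ: "finite (Q h)" for h
    by (rule finite_subset[of _ "S \<times> S"]) (auto simp: Q_def fS)
  have SV: "U \<subseteq> ?V" if "U \<in> S" for U
    using S that by (auto simp: k_spread_def k_subspaces_def)
  have N: "card S > 0"
    using S(2) fS by (simp add: card_gt_0_iff)
  have QZ: "card S \<le> card (Q h)" "h \<in> M" if "h \<in> gZ" for h
  proof -
    obtain z where z: "z \<in> Z" "h = compose ?V g z"
      using \<open>h \<in> gZ\<close> by (auto simp: gZ_def)
    have hU: "h ` U = g ` (z ` U)" if "U \<in> S" for U
      unfolding z(2) using SV[OF that] by (auto simp: compose_def image_image)
    \<comment> \<open>For h = gz each \<open>U\<close> in \<open>S\<close> is matched with zU, again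
      in \<open>S\<close>, since hU = g(zU).\<close>
    have "(\<lambda>U. (U, z ` U)) ` S \<subseteq> Q h"
    proof (intro image_subsetI)
      fix U assume U: "U \<in> S"
      then have "z ` U \<in> S"
        using Z(2)[OF z(1)] by blast
      then show "(U, z ` U) \<in> Q h"
        using U hU[OF U] unfolding Q_def by simp
    qed
    then have "card ((\<lambda>U. (U, z ` U)) ` S) \<le> card (Q h)"
      by (intro card_mono fQ)
    moreover have "card ((\<lambda>U. (U, z ` U)) ` S) = card S"
      by (intro card_image) (simp add: inj_on_def)
    ultimately show "card S \<le> card (Q h)"
      by simp
    obtain U where U: "U \<in> S"
      using S(2) by blast
    then have "z ` U \<in> S"
      using Z(2)[OF z(1)] by blast
    then have "h ` U \<in> (`) g ` S"
      unfolding hU[OF U] by (rule imageI)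
    moreover have "h ` U \<in> (`) h ` S"
      using U by (rule imageI)
    moreover have "h \<in> ?G"
      unfolding z(2) using z(1) Z(1) by (intro GL_compose g) auto
    ultimately show "h \<in> M"
      unfolding M_def by blast
  qed
  have QM: "1 \<le> card (Q h)" if h: "h \<in> M" for h
  proof -
    obtain U W where "U \<in> S" "W \<in> S" "g ` W = h ` U"
      using h unfolding M_def by blast
    then have "Q h \<noteq> {}"
      unfolding Q_def by force
    then show ?thesis
      using fQ[of h] by (simp add: Suc_le_eq card_gt_0_iff)
  qed
  have fM: "finite M"
    by (simp add: M_def finite_GL)
  have gZM: "gZ \<subseteq> M"
    using QZ(2) by blast
  have card_gZ: "card gZ = card Z"
    unfolding gZ_def
  proof (rule card_image, rule inj_onI)
    fix y z
    assume yz: "y \<in> Z" "z \<in> Z" "compose ?V g y = compose ?V g z"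
    have GL: "y \<in> ?G" "z \<in> ?G"
      using yz Z(1) by auto
    show "y = z"
    proof (rule extensionalityI[OF GL_D(1)[OF GL(1)] GL_D(1)[OF GL(2)]])
      fix v assume v: "v \<in> ?V"
      then have "g (y v) = g (z v)"
        using fun_cong[OF yz(3), of v] by (simp add: compose_def)
      then show "y v = z v"
        using inj_onD[OF GL_D(5)[OF g]] GL_D(6)[OF GL(1) v] GL_D(6)[OF GL(2) v] by blast
    qed
  qed
  \<comment> \<open>The left side weighs elements of \<open>M\<close> by 1 and those of
    \<open>gZ\<close> by \<open>card S\<close>, a lower bound for \<open>card (Q h)\<close> in both
    cases.\<close>
  have "card M + card Z * (card S - 1) = card (M - gZ) + card gZ * card S"
  proof -
    have "card M = card (M - gZ) + card gZ"
      using gZM fM by (simp add: card_Diff_subset finite_subset card_mono)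
    moreover have "card gZ * card S = card gZ + card gZ * (card S - 1)"
      using N by (cases "card S") auto
    ultimately show ?thesis
      by (simp add: card_gZ)
  qed
  also have "\<dots> \<le> (\<Sum>h\<in>M - gZ. card (Q h)) + (\<Sum>h\<in>gZ. card (Q h))"
    using sum_mono[of "M - gZ" "\<lambda>_. 1" "\<lambda>h. card (Q h)"]
      sum_mono[of gZ "\<lambda>_. card S" "\<lambda>h. card (Q h)"] QZ(1) QM
    by (intro add_mono) auto
  also have "\<dots> = (\<Sum>h\<in>M. card (Q h))"
    using sum.subset_diff[OF gZM fM, of "\<lambda>h. card (Q h)"] by simp
  also have "\<dots> \<le> (\<Sum>h\<in>?G. card (Q h))"
    by (intro sum_mono2 finite_GL) (auto simp: M_def)
  also have "\<dots> = (\<Sum>h\<in>?G. \<Sum>p\<in>{p \<in> S \<times> S. h ` fst p = g ` snd p}. 1)"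
    by (simp add: Q_def)
  \<comment> \<open>After the exchange of summation each inner sum counts the maps taking one fixed
    k-subspace to another.\<close>
  also have "\<dots> = (\<Sum>p\<in>S \<times> S. \<Sum>h\<in>{h \<in> ?G. h ` fst p = g ` snd p}. 1)"
    by (rule sum.swap_restrict) (simp_all add: finite_GL fS)
  also have "\<dots> \<le> (\<Sum>p\<in>S \<times> S.
      CARD('f) ^ (k * (n - k)) * card (GL TYPE('f) k) * card (GL TYPE('f) (n - k)))"
  proof (rule sum_mono)
    fix p
    assume "p \<in> S \<times> S"
    then have "fst p \<in> k_subspaces TYPE('f) n k" "g ` snd p \<in> k_subspaces TYPE('f) n k"
      using S(1) GL_image_k_subspaces[OF g] by (auto simp: k_spread_def)
    from card_GL_maps_to_le_GL[OF this \<open>k \<le> n\<close>]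
    show "(\<Sum>h\<in>{h \<in> ?G. h ` fst p = g ` snd p}. 1) \<le>
        CARD('f) ^ (k * (n - k)) * card (GL TYPE('f) k) * card (GL TYPE('f) (n - k))"
      by simp
  qed
  finally show ?thesis
    by (simp add: M_def power2_eq_square card_cartesian_product)
qed

section \<open>From disjoint translates to a partial parallelism\<close>

lemma card_le_P:
  assumes "partial_k_parallelism TYPE('f::{field,finite}) n k C"
  shows "card C \<le> P TYPE('f) n k"
proof -
  \<comment> \<open>Finiteness of the set of parallelisms makes \<open>Max\<close> in the definition
    of \<open>P\<close> an actual upper bound.\<close>
  have "{C. partial_k_parallelism TYPE('f) n k C} \<subseteq> Pow (Pow (Pow (V TYPE('f) n)))"
  proof (intro subsetI PowI)
    fix C A U v
    assume "C \<in> {C. partial_k_parallelism TYPE('f) n k C}" "A \<in> C" "U \<in> A" "v \<in> U"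
    then show "v \<in> V TYPE('f) n"
      unfolding partial_k_parallelism_def k_spread_def k_subspaces_def by blast
  qed
  then have "finite {C. partial_k_parallelism TYPE('f) n k C}"
    by (rule finite_subset) (simp add: finite_V)
  then show ?thesis
    unfolding P_def using assms by (intro Max_ge) auto
qed

text \<open>Calling two group elements related when their translates of \<open>S\<close> share a
  member, a large set of unrelated elements yields disjoint spreads. As \<open>S\<close> is
  nonempty, different elements of this set give different spreads.\<close>

lemma ex_partial_k_parallelism:
  fixes S :: "(nat \<Rightarrow> 'f::{field,finite}) set set"
  assumes S: "k_spread TYPE('f) n k S" "S \<noteq> {}"
    and deg: "\<And>g. g \<in> GL TYPE('f) n \<Longrightarrow>
      card {h \<in> GL TYPE('f) n. (`) g ` S \<inter> (`) h ` S \<noteq> {}} \<le> d"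
  shows "card (GL TYPE('f) n) \<le> P TYPE('f) n k * d"
proof -
  obtain T where T: "T \<subseteq> GL TYPE('f) n" "card (GL TYPE('f) n) \<le> card T * d"
    and disj: "\<And>g h. g \<in> T \<Longrightarrow> h \<in> T \<Longrightarrow> g \<noteq> h \<Longrightarrow> (`) g ` S \<inter> (`) h ` S = {}"
  proof (rule ex_large_independent_set[where G = "GL TYPE('f) n" and d = d
        and R = "\<lambda>g h. (`) g ` S \<inter> (`) h ` S \<noteq> {}"])
    show "(`) g ` S \<inter> (`) g ` S \<noteq> {}" for g
      using S(2) by simp
    show "(`) h ` S \<inter> (`) g ` S \<noteq> {}" if "(`) g ` S \<inter> (`) h ` S \<noteq> {}" for g h
      using that by (simp add: Int_commute)
    fix T
    assume T: "T \<subseteq> GL TYPE('f) n" "card (GL TYPE('f) n) \<le> card T * d"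
      and "\<And>g h. g \<in> T \<Longrightarrow> h \<in> T \<Longrightarrow> g \<noteq> h \<Longrightarrow> \<not> (`) g ` S \<inter> (`) h ` S \<noteq> {}"
    then show thesis
      by (intro that) simp_all
  qed (rule finite_GL, rule deg)
  let ?C = "(\<lambda>g. (`) g ` S) ` T"
  have "partial_k_parallelism TYPE('f) n k ?C"
    unfolding partial_k_parallelism_def
  proof (intro conjI ballI)
    show "k_spread TYPE('f) n k A" if "A \<in> ?C" for A
      using that T(1) k_spread_image S(1) by blast
    show "disjoint ?C"
    proof (rule disjointI)
      fix A B
      assume AB: "A \<in> ?C" "B \<in> ?C" "A \<noteq> B"
      then obtain g h where "g \<in> T" "h \<in> T" "A = (`) g ` S" "B = (`) h ` S"
        by auto
      with AB(3) disj show "A \<inter> B = {}"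
        by metis
    qed
  qed
  then have "card ?C \<le> P TYPE('f) n k"
    by (rule card_le_P)
  moreover have "card ?C = card T"
  proof (rule card_image, rule inj_onI, rule ccontr)
    fix g h
    assume gh: "g \<in> T" "h \<in> T" "(`) g ` S = (`) h ` S" "g \<noteq> h"
    from disj[OF gh(1,2,4)] gh(3) S(2) show False
      by simp
  qed
  ultimately have "card T * d \<le> P TYPE('f) n k * d"
    by simp
  with T(2) show ?thesis
    by linarith
qed

theorem theorem3p3:
  fixes q n k :: nat
  assumes "primepow q" and "CARD('f::{field,finite}) = q"
    and "0 < k" and "k < n" and "k dvd n"
  shows "real (P TYPE('f) n k) \<ge>
    real (card (GL TYPE('f) n)) /
      (((real q ^ n - 1) / (real q ^ k - 1))\<^sup>2 * real q ^ (k * (n - k))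
          * real (card (GL TYPE('f) k)) * real (card (GL TYPE('f) (n - k)))
        - (real q ^ n - 1)\<^sup>2 / (real q ^ k - 1) + (real q ^ n - 1))"
proof -
  have q: "2 \<le> q"
    using CARD_ge_2[where 'f = 'f] assms(2) by simp
  obtain S Z where S: "k_spread TYPE('f) n k S" and Z: "Z \<subseteq> GL TYPE('f) n"
    "card Z = q ^ n - 1" "\<And>z. z \<in> Z \<Longrightarrow> (`) z ` S = S"
    using ex_spread_with_stabilizer[where 'f = 'f and k = k and n = n] assms by auto
  define N where "N = card S"
  define s where "s = q ^ (k * (n - k)) * card (GL TYPE('f) k) * card (GL TYPE('f) (n - k))"
  \<comment> \<open>The denominator of the bound as a natural number; the subtraction is shown below
    not to truncate.\<close>
  define d where "d = N\<^sup>2 * s - (q ^ n - 1) * (N - 1)"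
  have gt1: "1 < q ^ k" "1 < q ^ n"
    using one_less_power[of q k] one_less_power[of q n] q assms(3,4) by auto
  have N: "N * (q ^ k - 1) = q ^ n - 1"
    using card_k_spread[OF S] assms(2) by (simp add: N_def)
  then have "N > 0"
    using gt1 by (intro Nat.gr0I) auto
  then have S0: "S \<noteq> {}"
    by (auto simp: N_def)
  have bound: "card {h \<in> GL TYPE('f) n. (`) g ` S \<inter> (`) h ` S \<noteq> {}} + (q ^ n - 1) * (N - 1) \<le> N\<^sup>2 * s"
    if "g \<in> GL TYPE('f) n" for g
    using card_meeting_translates[OF S S0 _ Z(1,3) that] assms by (simp add: N_def s_def Z(2))
  have le_d: "card {h \<in> GL TYPE('f) n. (`) g ` S \<inter> (`) h ` S \<noteq> {}} \<le> d"
    if "g \<in> GL TYPE('f) n" for g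
    using bound[OF that] by (simp add: d_def)
  \<comment> \<open>Any element of the group would serve here: its translate meets itself, so
    \<open>d\<close> is positive and the final division is legitimate. The bound at \<open>z\<close>
    also yields \<open>le\<close>.\<close>
  obtain z where z: "z \<in> Z"
    using Z(2) gt1(2) by (metis card.empty ex_in_conv zero_less_diff less_numeral_extra(3))
  then have zG: "z \<in> GL TYPE('f) n"
    using Z(1) by blast
  then have "card {h \<in> GL TYPE('f) n. (`) z ` S \<inter> (`) h ` S \<noteq> {}} > 0"
    using S0 finite_GL[of n, where 'f = 'f] by (auto simp: card_gt_0_iff)
  with bound[OF zG] le_d[OF zG] have d: "d > 0" and le: "(q ^ n - 1) * (N - 1) \<le> N\<^sup>2 * s"
    by linarith+
  have N_real: "real N = (real q ^ n - 1) / (real q ^ k - 1)"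
  proof -
    have "real N * (real q ^ k - 1) = real q ^ n - 1"
      using arg_cong[OF N, of real] gt1 by (simp add: of_nat_diff)
    moreover have "real q ^ k - 1 \<noteq> 0"
      using gt1(1) by (metis eq_iff_diff_eq_0 of_nat_1 of_nat_eq_iff of_nat_power less_irrefl)
    ultimately show ?thesis
      by (simp add: eq_divide_eq)
  qed
  \<comment> \<open>By \<open>le\<close> and N > 0 the natural subtractions in \<open>d\<close>
    agree with the real ones.\<close>
  have "real d = (real N)\<^sup>2 * real s - (real q ^ n - 1) * (real N - 1)"
    using le gt1 \<open>N > 0\<close> by (simp add: d_def of_nat_diff)
  also have "\<dots> = (real N)\<^sup>2 * real s - (real q ^ n - 1) * real N + (real q ^ n - 1)"
    by (simp add: algebra_simps)
  \<comment> \<open>Substituting N = (q^n - 1)/(q^k - 1) turns (q^n - 1) N into (q^n - 1)^2/(q^k -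
    1).\<close>
  also have "\<dots> = ((real q ^ n - 1) / (real q ^ k - 1))\<^sup>2 * real q ^ (k * (n - k))
          * real (card (GL TYPE('f) k)) * real (card (GL TYPE('f) (n - k)))
        - (real q ^ n - 1)\<^sup>2 / (real q ^ k - 1) + (real q ^ n - 1)" (is "_ = ?D")
    unfolding N_real by (simp add: s_def power2_eq_square mult.assoc)
  finally have D: "?D = real d" ..
  have "card (GL TYPE('f) n) \<le> P TYPE('f) n k * d"
    using ex_partial_k_parallelism[OF S S0 le_d] .
  then have "real (card (GL TYPE('f) n)) \<le> real (P TYPE('f) n k) * real d"
    by (metis of_nat_le_iff of_nat_mult)
  then show ?thesis
    unfolding D using d by (simp add: divide_le_eq)
qed

end
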